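(* Let $X$ be a compact metric space and $\varphi:\mathbb{T}^+\times X\to X$ a dynamical system. The set $\mathsf{ANbhd}(\varphi)$ of attracting neighborhoods is a bounded, distributive lattice with respect to the binary operations $\vee=\cup$ and $\wedge=\cap$. The neutral elements are $0=\varnothing$ and $1=X$.
   Context: $\mathbb{T}$ is $\mathbb{Z}$ or $\mathbb{R}$, $\mathbb{T}^+=\{t\in\mathbb{T}:t\ge0\}$. A dynamical system is a continuous map $\varphi:\mathbb{T}^+\times X\to X$ with $\varphi(0,x)=x$ and $\varphi(t,\varphi(s,x))=\varphi(t+s,x)$ for $s,t\in\mathbb{T}^+$ (no invertibility assumed). For $U\subset X$, $\omega(U)=\bigcap_{t\ge0}\mathrm{cl}\big(\bigcup_{s\ge t}\varphi(s,U)\big)$. $U\subset X$ is an attracting neighborhood if $\omega(U)\subset\mathrm{int}(U)$; $\mathsf{ANbhd}(\varphi)$ is the set of all such $U$. *)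

theory Defs
  imports "HOL-Analysis.Analysis"
begin

text \<open>
  Lattices as algebraic structures on a carrier set. The operations are only constrained on the
  carrier, and closure of the carrier under them is part of the axioms.
\<close>

locale lattice_on =
  fixes L :: "'b set"
    and join :: "'b \<Rightarrow> 'b \<Rightarrow> 'b" (infixl "\<squnion>" 65)
    and meet :: "'b \<Rightarrow> 'b \<Rightarrow> 'b" (infixl "\<sqinter>" 70)
  assumes join_closed: "\<lbrakk>a \<in> L; b \<in> L\<rbrakk> \<Longrightarrow> a \<squnion> b \<in> L"
    and meet_closed: "\<lbrakk>a \<in> L; b \<in> L\<rbrakk> \<Longrightarrow> a \<sqinter> b \<in> L"
    and join_idem: "a \<in> L \<Longrightarrow> a \<squnion> a = a"
    and meet_idem: "a \<in> L \<Longrightarrow> a \<sqinter> a = a"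
    and join_commute: "\<lbrakk>a \<in> L; b \<in> L\<rbrakk> \<Longrightarrow> a \<squnion> b = b \<squnion> a"
    and meet_commute: "\<lbrakk>a \<in> L; b \<in> L\<rbrakk> \<Longrightarrow> a \<sqinter> b = b \<sqinter> a"
    and join_assoc: "\<lbrakk>a \<in> L; b \<in> L; c \<in> L\<rbrakk> \<Longrightarrow> (a \<squnion> b) \<squnion> c = a \<squnion> (b \<squnion> c)"
    and meet_assoc: "\<lbrakk>a \<in> L; b \<in> L; c \<in> L\<rbrakk> \<Longrightarrow> (a \<sqinter> b) \<sqinter> c = a \<sqinter> (b \<sqinter> c)"
    and join_absorb: "\<lbrakk>a \<in> L; b \<in> L\<rbrakk> \<Longrightarrow> a \<squnion> (a \<sqinter> b) = a"
    and meet_absorb: "\<lbrakk>a \<in> L; b \<in> L\<rbrakk> \<Longrightarrow> a \<sqinter> (a \<squnion> b) = a"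

locale distributive_lattice_on = lattice_on +
  assumes join_distrib: "\<lbrakk>a \<in> L; b \<in> L; c \<in> L\<rbrakk> \<Longrightarrow> a \<squnion> (b \<sqinter> c) = (a \<squnion> b) \<sqinter> (a \<squnion> c)"
    and meet_distrib: "\<lbrakk>a \<in> L; b \<in> L; c \<in> L\<rbrakk> \<Longrightarrow> a \<sqinter> (b \<squnion> c) = (a \<sqinter> b) \<squnion> (a \<sqinter> c)"

locale bounded_distributive_lattice_on = distributive_lattice_on L join meet
  for L :: "'b set"
    and join :: "'b \<Rightarrow> 'b \<Rightarrow> 'b" (infixl "\<squnion>" 65)
    and meet :: "'b \<Rightarrow> 'b \<Rightarrow> 'b" (infixl "\<sqinter>" 70) +
  fixes zero :: 'b ("\<zero>")
    and one :: 'b ("\<one>")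
  assumes zero_closed: "\<zero> \<in> L"
    and one_closed: "\<one> \<in> L"
    and zero_join: "a \<in> L \<Longrightarrow> \<zero> \<squnion> a = a"
    and zero_meet: "a \<in> L \<Longrightarrow> \<zero> \<sqinter> a = \<zero>"
    and one_join: "a \<in> L \<Longrightarrow> \<one> \<squnion> a = \<one>"
    and one_meet: "a \<in> L \<Longrightarrow> \<one> \<sqinter> a = a"

text \<open>
  The time set \<open>T\<close> is a set of reals, either \<open>\<int>\<close> or \<open>\<real>\<close>; in both cases
  the topology inherited from the reals is the usual one (discrete for \<open>\<int>\<close>).
\<close>

definition nonneg_times :: "real set \<Rightarrow> real set" where
  "nonneg_times T = {t \<in> T. 0 \<le> t}"

definition dynamical_system :: "real set \<Rightarrow> 'a topology \<Rightarrow> (real \<times> 'a \<Rightarrow> 'a) \<Rightarrow> bool" where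
  "dynamical_system T X \<phi> \<longleftrightarrow>
     continuous_map (prod_topology (top_of_set (nonneg_times T)) X) X \<phi> \<and>
     (\<forall>x \<in> topspace X. \<phi> (0, x) = x) \<and>
     (\<forall>s \<in> nonneg_times T. \<forall>t \<in> nonneg_times T. \<forall>x \<in> topspace X.
        \<phi> (t, \<phi> (s, x)) = \<phi> (t + s, x))"

definition omega_limit ::
    "real set \<Rightarrow> 'a topology \<Rightarrow> (real \<times> 'a \<Rightarrow> 'a) \<Rightarrow> 'a set \<Rightarrow> 'a set" where
  "omega_limit T X \<phi> U =
     (\<Inter>t \<in> nonneg_times T.
        X closure_of (\<Union>s \<in> {s \<in> nonneg_times T. t \<le> s}. (\<lambda>x. \<phi> (s, x)) ` U))"

definition ANbhd :: "real set \<Rightarrow> 'a topology \<Rightarrow> (real \<times> 'a \<Rightarrow> 'a) \<Rightarrow> 'a set set" where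
  "ANbhd T X \<phi> = {U. U \<subseteq> topspace X \<and> omega_limit T X \<phi> U \<subseteq> X interior_of U}"

end

theory Submission
  imports Defs
begin

text \<open>The lattice identities are those of sets, so the content is that attracting
  neighborhoods are closed under \<open>\<union>\<close> and \<open>\<inter>\<close> and include the
  two bounds. Omega limits are monotone and commute with binary unions
  (\<open>omega_limit_Un\<close>, the key step). Hence omega(U \<inter> V) lies in int U \<inter>
  int V = int(U \<inter> V), and omega(U \<union> V) lies in int U \<union> int V, a subset of int(U
  \<union> V). For the bounds, omega of the empty set is empty and the whole space is its own
  interior.\<close>

lemma omega_limit_mono:
  "U \<subseteq> V \<Longrightarrow> omega_limit T X \<phi> U \<subseteq> omega_limit T X \<phi> V"
  unfolding omega_limit_def by (intro INF_mono' closure_of_mono UN_mono image_mono) auto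

text \<open>\<open>0 \<in> T\<close> makes the index set of the intersection nonempty; over no times
  at all the intersection would be \<open>UNIV\<close>.\<close>

lemma omega_limit_empty:
  "0 \<in> T \<Longrightarrow> omega_limit T X \<phi> {} = {}"
  by (auto simp: omega_limit_def nonneg_times_def)

lemma omega_limit_subset_topspace:
  "0 \<in> T \<Longrightarrow> omega_limit T X \<phi> U \<subseteq> topspace X"
  using closure_of_subset_topspace by (fastforce simp: omega_limit_def nonneg_times_def)

text \<open>Closure commutes with binary unions and the closed tails shrink as time grows. A point
  that leaves the tails of U and of V at possibly different times has therefore left both by the
  later one.\<close>

lemma omega_limit_Un:
  "omega_limit T X \<phi> (U \<union> V) = omega_limit T X \<phi> U \<union> omega_limit T X \<phi> V"
proof
  define tail where
    "tail W t = (\<Union>s \<in> {s \<in> nonneg_times T. t \<le> s}. (\<lambda>x. \<phi> (s, x)) ` W)" for W t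
  have omega: "omega_limit T X \<phi> W = (\<Inter>t \<in> nonneg_times T. X closure_of tail W t)" for W
    by (simp add: omega_limit_def tail_def)
  have antimono: "X closure_of tail W t \<subseteq> X closure_of tail W s" if "s \<le> t" for W s t
    using that by (intro closure_of_mono) (auto simp: tail_def)
  have tail_Un: "tail (U \<union> V) t = tail U t \<union> tail V t" for t
    by (auto simp: tail_def)
  show "omega_limit T X \<phi> (U \<union> V) \<subseteq> omega_limit T X \<phi> U \<union> omega_limit T X \<phi> V"
  proof (rule subsetI, rule ccontr)
    fix x
    assume x: "x \<in> omega_limit T X \<phi> (U \<union> V)"
      and "x \<notin> omega_limit T X \<phi> U \<union> omega_limit T X \<phi> V"
    then obtain s t where st: "s \<in> nonneg_times T" "t \<in> nonneg_times T"
      and x_notin: "x \<notin> X closure_of tail U s" "x \<notin> X closure_of tail V t"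
      by (auto simp: omega)
    \<comment> \<open>Times are linearly ordered, so the maximum is one of \<open>s\<close> and
      \<open>t\<close> and serves as the common time.\<close>
    have "max s t \<in> nonneg_times T"
      using st by (simp add: max_def)
    then have "x \<in> X closure_of tail U (max s t) \<union> X closure_of tail V (max s t)"
      using x by (auto simp: omega tail_Un closure_of_Un)
    then show False
      using x_notin antimono[of s "max s t" U] antimono[of t "max s t" V] by auto
  qed
qed (simp add: omega_limit_mono)

lemma bounded_distributive_lattice_on_ANbhd:
  assumes "0 \<in> T"
  shows "bounded_distributive_lattice_on (ANbhd T X \<phi>) (\<union>) (\<inter>) {} (topspace X)"
proof unfold_locales
  fix U V
  assume UV: "U \<in> ANbhd T X \<phi>" "V \<in> ANbhd T X \<phi>"
  have "X interior_of U \<union> X interior_of V \<subseteq> X interior_of (U \<union> V)"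
    by (simp add: interior_of_mono)
  with UV show "U \<union> V \<in> ANbhd T X \<phi>"
    by (auto simp: ANbhd_def omega_limit_Un)
  have "omega_limit T X \<phi> (U \<inter> V) \<subseteq> omega_limit T X \<phi> U \<inter> omega_limit T X \<phi> V"
    by (simp add: omega_limit_mono)
  with UV show "U \<inter> V \<in> ANbhd T X \<phi>"
    by (auto simp: ANbhd_def interior_of_Int)
next
  show "{} \<in> ANbhd T X \<phi>"
    using assms by (simp add: ANbhd_def omega_limit_empty)
  show "topspace X \<in> ANbhd T X \<phi>"
    using assms by (simp add: ANbhd_def omega_limit_subset_topspace)
\<comment> \<open>What remains are set identities; those for the top element use that members of
  \<open>ANbhd\<close> are subsets of \<open>topspace X\<close>.\<close>
qed (auto simp: ANbhd_def)

theorem proposition4p1: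
  fixes T :: "real set" and X :: "'a metric" and \<phi> :: "real \<times> 'a \<Rightarrow> 'a"
  assumes "T = \<int> \<or> T = \<real>"
    and "compact_space (mtopology_of X)"
    and "dynamical_system T (mtopology_of X) \<phi>"
  shows "bounded_distributive_lattice_on (ANbhd T (mtopology_of X) \<phi>) (\<union>) (\<inter>) {} (mspace X)"
proof -
  have "0 \<in> T"
    using assms(1) by auto
  then show ?thesis
    using bounded_distributive_lattice_on_ANbhd[of T "mtopology_of X" \<phi>] by simp
qed

end
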